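(* Let $\psi$ be a bi-criteria function with $\psi(a,b)=\psi(b,a)>0$ for all $a,b$. Let $T\ge2$, let $\lambda_1,\dots,\lambda_T>0$ with $\lambda_T=1$, and suppose $\epsilon=\min_{i\le T-1}\tfrac12|\lambda_i-1|\ne0$. Then there exists an example with three distinct labels $A,B,C$ such that $\Phi(A)=\Phi(B)<\Phi(C)$, and for every $i\le T-1$ $$\mathcal{O}(\lambda_i)=\begin{cases}A&\text{if }\lambda_i>1,\\ B&\text{otherwise},\end{cases}$$ while $\mathcal{O}(1)=C$. (That is, the oracle oscillates between the two labels $A$ and $B$ until $\lambda^*=1$ is used, and only then returns $C$.)
   Context: Each label $y$ is identified with a point $(h(y),g(y))\in\mathbb{R}\times\mathbb{R}_+$, and $\Phi(y)=\psi(h(y),g(y))$. A bi-criteria function $\psi$ is a real function which, on the domain $K_0=\{(a,b):\psi(a,b)\ge0\}$, is differentiable, quasi-concave (all superlevel sets $\{\psi\ge\beta\}$, $\beta\ge0$, are convex), nondecreasing in each argument, and satisfies $\psi(a+\epsilon',b+\epsilon')>\psi(a,b)$ for all $\epsilon'>0$. For $\lambda>0$ the $\lambda$-oracle returns $\mathcal{O}(\lambda)=\arg\max_{y\in\{A,B,C\}}(h(y)+\lambda g(y))$. *)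

theory Defs
  imports "HOL-Analysis.Analysis"
begin

definition superlevel :: "(real \<times> real \<Rightarrow> real) \<Rightarrow> real \<Rightarrow> (real \<times> real) set"
  where "superlevel \<psi> \<beta> = {p. \<psi> p \<ge> \<beta>}"

text \<open>
  All regularity conditions are imposed only on \<open>K\<^sub>0 = superlevel \<psi> 0\<close>; outside it the total
  function \<open>\<psi>\<close> is unconstrained. Differentiability is taken within \<open>K\<^sub>0\<close>.
\<close>

definition bi_criteria :: "(real \<times> real \<Rightarrow> real) \<Rightarrow> bool"
  where "bi_criteria \<psi> \<longleftrightarrow>
    \<psi> differentiable_on superlevel \<psi> 0 \<and>
    (\<forall>\<beta>\<ge>0. convex (superlevel \<psi> \<beta>)) \<and>
    (\<forall>b. mono_on {a. (a, b) \<in> superlevel \<psi> 0} (\<lambda>a. \<psi> (a, b))) \<and>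
    (\<forall>a. mono_on {b. (a, b) \<in> superlevel \<psi> 0} (\<lambda>b. \<psi> (a, b))) \<and>
    (\<forall>(a, b) \<in> superlevel \<psi> 0. \<forall>\<epsilon>'>0. \<psi> (a + \<epsilon>', b + \<epsilon>') > \<psi> (a, b))"

datatype label = A | B | C

definition Phi :: "(real \<times> real \<Rightarrow> real) \<Rightarrow> ('y \<Rightarrow> real) \<Rightarrow> ('y \<Rightarrow> real) \<Rightarrow> 'y \<Rightarrow> real"
  where "Phi \<psi> h g y = \<psi> (h y, g y)"

text \<open>
  The full set of maximisers over the label set \<open>Y\<close>. That the maximisation returns \<open>y\<close>
  is expressed by this set being \<open>{y}\<close>, so that no tie-breaking rule is involved.
\<close>

definition lambda_oracle :: "'y set \<Rightarrow> ('y \<Rightarrow> real) \<Rightarrow> ('y \<Rightarrow> real) \<Rightarrow> real \<Rightarrow> 'y set"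
  where "lambda_oracle Y h g l = {y. is_arg_max (\<lambda>y. h y + l * g y) (\<lambda>y. y \<in> Y) y}"

end

theory Submission
  imports Defs
begin

text \<open>
  Take \<open>A = (0, 2)\<close>, \<open>B = (2, 0)\<close> and \<open>C = (1 + \<delta>, 1 + \<delta>)\<close> for a small \<open>\<delta> > 0\<close>. By symmetry and
  quasi-concavity \<open>\<psi>\<close> is at least as large at the midpoint \<open>(1, 1)\<close> of \<open>A\<close> and \<open>B\<close> as at
  \<open>A\<close> and \<open>B\<close>, and it is strictly larger still at \<open>C\<close>. The scores at \<open>\<lambda>\<close>, with
  \<open>1 + \<lambda>\<close> subtracted, are \<open>\<lambda> - 1\<close>, \<open>1 - \<lambda>\<close> and \<open>\<delta> * (1 + \<lambda>)\<close>; so \<open>C\<close> wins at \<open>\<lambda> = 1\<close>, but loses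
  to \<open>A\<close> or \<open>B\<close> as soon as \<open>\<delta> * (1 + \<lambda>) < \<bar>\<lambda> - 1\<bar>\<close>.
\<close>

lemma lambda_oracle_eq_singleton:
  assumes "y \<in> Y" and "\<And>z. z \<in> Y \<Longrightarrow> z \<noteq> y \<Longrightarrow> h z + l * g z < h y + l * g y"
  shows "lambda_oracle Y h g l = {y}"
proof -
  have "is_arg_max (\<lambda>y. h y + l * g y) (\<lambda>y. y \<in> Y) z \<longleftrightarrow> z = y" for z
    unfolding is_arg_max_def using assms by (metis less_asym)
  then show ?thesis by (simp add: lambda_oracle_def)
qed

lemma bi_criteria_antidiagonal_less:
  assumes bi: "bi_criteria \<psi>" and sym: "\<psi> (a, b) = \<psi> (b, a)" and nonneg: "\<psi> (a, b) \<ge> 0"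
    and "\<delta> > 0"
  shows "\<psi> (a, b) < \<psi> ((a + b) / 2 + \<delta>, (a + b) / 2 + \<delta>)"
proof -
  let ?m = "(a + b) / 2"
  have "convex (superlevel \<psi> (\<psi> (a, b)))"
    using bi nonneg unfolding bi_criteria_def by blast
  moreover have "(a, b) \<in> superlevel \<psi> (\<psi> (a, b))" "(b, a) \<in> superlevel \<psi> (\<psi> (a, b))"
    using sym by (simp_all add: superlevel_def)
  ultimately have "(1/2) *\<^sub>R (a, b) + (1/2) *\<^sub>R (b, a) \<in> superlevel \<psi> (\<psi> (a, b))"
    by (intro convexD) auto
  then have le: "\<psi> (a, b) \<le> \<psi> (?m, ?m)"
    by (simp add: superlevel_def add_divide_distrib add.commute)
  then have "(?m, ?m) \<in> superlevel \<psi> 0"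
    using nonneg by (simp add: superlevel_def)
  then have "\<psi> (?m, ?m) < \<psi> (?m + \<delta>, ?m + \<delta>)"
    using bi \<open>\<delta> > 0\<close> unfolding bi_criteria_def by fast
  with le show ?thesis by simp
qed

text \<open>For \<open>x > -1\<close> with \<open>\<bar>x - 1\<bar> \<ge> 2 * \<epsilon>\<close>,
  the ratio \<open>\<bar>x - 1\<bar> / (1 + x)\<close> is smallest at
  \<open>x = 1 + 2 * \<epsilon>\<close>, with value \<open>\<epsilon> / (1 + \<epsilon>)\<close>.
  Half of it leaves room for strictness.\<close>

lemma gap_less_abs_diff_one:
  fixes \<epsilon> x :: real
  assumes "\<epsilon> > 0" and "\<epsilon> \<le> \<bar>x - 1\<bar> / 2"
  shows "\<epsilon> / (2 * (1 + \<epsilon>)) * (1 + x) < \<bar>x - 1\<bar>"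
proof -
  have "\<epsilon> * (1 + x) < \<bar>x - 1\<bar> * (2 * (1 + \<epsilon>))"
  proof (cases "x > 1")
    case True
    have "0 < \<epsilon> * (x - 1)" using True \<open>\<epsilon> > 0\<close> by simp
    with True assms(2) show ?thesis by (simp add: algebra_simps)
  next
    case False
    \<comment> \<open>With \<open>\<epsilon> * x\<close> treated as an atom, the goal is linear: it
      reads \<open>3 * \<epsilon> * x < 2 * (1 - x) + \<epsilon>\<close>, where the left is at most
      \<open>3 * \<epsilon>\<close> and the right at least \<open>5 * \<epsilon>\<close>.\<close>
    have "\<epsilon> * x \<le> \<epsilon>" using False \<open>\<epsilon> > 0\<close> by (simp add: mult_left_le)
    moreover have "2 * \<epsilon> \<le> 1 - x" using False assms(2) by simp
    ultimately have "\<epsilon> * (1 + x) < (1 - x) * (2 * (1 + \<epsilon>))"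
      using \<open>\<epsilon> > 0\<close> unfolding ring_distribs mult.commute[of x] by linarith
    with False show ?thesis by simp
  qed
  then show ?thesis using \<open>\<epsilon> > 0\<close> by (simp add: field_simps)
qed

theorem lemma13:
  fixes \<psi> :: "real \<times> real \<Rightarrow> real" and T :: nat and l :: "nat \<Rightarrow> real" and \<epsilon> :: real
  assumes "bi_criteria \<psi>"
    and "\<And>a b. \<psi> (a, b) = \<psi> (b, a)"
    and "\<And>a b. \<psi> (a, b) > 0"
    and "T \<ge> 2"
    and "\<And>i. i \<in> {1..T} \<Longrightarrow> l i > 0"
    and "l T = 1"
    and "\<epsilon> = (MIN i\<in>{1..T - 1}. 1 / 2 * \<bar>l i - 1\<bar>)"
    and "\<epsilon> \<noteq> 0"
  shows "\<exists>h g :: label \<Rightarrow> real.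
    (\<forall>y. g y \<ge> 0) \<and>
    Phi \<psi> h g A = Phi \<psi> h g B \<and> Phi \<psi> h g B < Phi \<psi> h g C \<and>
    (\<forall>i\<in>{1..T - 1}. lambda_oracle {A, B, C} h g (l i) = (if l i > 1 then {A} else {B})) \<and>
    lambda_oracle {A, B, C} h g 1 = {C}"
proof -
  define \<delta> where "\<delta> = \<epsilon> / (2 * (1 + \<epsilon>))"
  define h :: "label \<Rightarrow> real" where "h = case_label 0 2 (1 + \<delta>)"
  define g :: "label \<Rightarrow> real" where "g = case_label 2 0 (1 + \<delta>)"
  have \<epsilon>_le: "\<epsilon> \<le> \<bar>l i - 1\<bar> / 2" if "i \<in> {1..T - 1}" for i
  proof -
    have "\<epsilon> \<le> 1 / 2 * \<bar>l i - 1\<bar>"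
      unfolding assms(7) using that by (intro Min_le) auto
    then show ?thesis by simp
  qed
  \<comment> \<open>\<open>T \<ge> 2\<close> makes the index set nonempty, so the minimum is
    attained and is a nonnegative value.\<close>
  have "\<epsilon> \<in> (\<lambda>i. 1 / 2 * \<bar>l i - 1\<bar>) ` {1..T - 1}"
    unfolding assms(7) using \<open>T \<ge> 2\<close> by (intro Min_in) auto
  then have "\<epsilon> > 0" using \<open>\<epsilon> \<noteq> 0\<close> by auto
  then have "\<delta> > 0" by (simp add: \<delta>_def)
  have "lambda_oracle {A, B, C} h g (l i) = (if l i > 1 then {A} else {B})"
    if i: "i \<in> {1..T - 1}" for i
  proof -
    have gap: "\<delta> * (1 + l i) < \<bar>l i - 1\<bar>"
      unfolding \<delta>_def using \<open>\<epsilon> > 0\<close> \<epsilon>_le[OF i] by (intro gap_less_abs_diff_one)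
    \<comment> \<open>Only strict cases remain, so the \<open>else\<close> branch never meets
      \<open>l i = 1\<close>, where \<open>C\<close> would win.\<close>
    have "l i \<noteq> 1" using \<epsilon>_le[OF i] \<open>\<epsilon> > 0\<close> by auto
    then consider "l i > 1" | "l i < 1" by linarith
    then show ?thesis
    proof cases
      case 1
      have "lambda_oracle {A, B, C} h g (l i) = {A}"
        using 1 gap by (intro lambda_oracle_eq_singleton) (auto simp: h_def g_def algebra_simps)
      with 1 show ?thesis by simp
    next
      case 2
      have "lambda_oracle {A, B, C} h g (l i) = {B}"
        using 2 gap by (intro lambda_oracle_eq_singleton) (auto simp: h_def g_def algebra_simps)
      with 2 show ?thesis by simp
    qed
  qed
  moreover have "lambda_oracle {A, B, C} h g 1 = {C}"
    using \<open>\<delta> > 0\<close> by (intro lambda_oracle_eq_singleton) (auto simp: h_def g_def)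
  moreover have "Phi \<psi> h g A = Phi \<psi> h g B"
    using assms(2) by (simp add: Phi_def h_def g_def)
  \<comment> \<open>The instance \<open>a = 2\<close>, \<open>b = 0\<close> is the point of
    \<open>B\<close>; its mirror image is \<open>A\<close>.\<close>
  moreover have "Phi \<psi> h g B < Phi \<psi> h g C"
    using bi_criteria_antidiagonal_less[OF assms(1) assms(2) less_imp_le[OF assms(3)] \<open>\<delta> > 0\<close>, of 2 0]
    by (simp add: Phi_def h_def g_def)
  moreover have "g y \<ge> 0" for y
    using \<open>\<delta> > 0\<close> by (cases y) (simp_all add: g_def)
  ultimately show ?thesis by blast
qed

end
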